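(* Let $q$ be an odd prime power and $r\ge 2$ an integer. Let $F$ be a quadratic form on $\mathbb{F}_q^{r+1}$ and $\mathcal{Q}$ the quadric of $\mathrm{PG}(r,q)$ it defines, i.e. the set of points $P(x_0,\dots,x_r)$ with $F(x_0,\dots,x_r)=0$. Let $\mathcal{P}_1$ (resp. $\mathcal{P}_2$) be the set of points $P(x_0,\dots,x_r)\notin\mathcal{Q}$ for which $F(x_0,\dots,x_r)$ is a non-square (resp. a non-zero square) in $\mathbb{F}_q$. Define arcs $\mathcal{K}_1,\mathcal{K}_2$ on $\mathrm{PG}(r,q)$ by: $\mathcal{K}_1(P)=\frac{q+1}{2}$ if $P\in\mathcal{Q}$, $\mathcal{K}_1(P)=1$ if $P\in\mathcal{P}_1$, $\mathcal{K}_1(P)=0$ if $P\in\mathcal{P}_2$; and $\mathcal{K}_2(P)=\frac{q+1}{2}$ if $P\in\mathcal{Q}$, $\mathcal{K}_2(P)=0$ if $P\in\mathcal{P}_1$, $\mathcal{K}_2(P)=1$ if $P\in\mathcal{P}_2$. Then $\mathcal{K}_i$ is a $\left(\frac{q+1}{2}\bmod q\right)$-arc of $\mathrm{PG}(r,q)$ for $i=1,2$. Moreover, if $\mathcal{Q}$ is non-degenerate, then neither $\mathcal{K}_1$ nor $\mathcal{K}_2$ is lifted.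
   Context: An arc in $\mathrm{PG}(r,q)$ is a map $\mathcal{K}$ from the point set to the non-negative integers; $\mathcal{K}(S)=\sum_{Q\in S}\mathcal{K}(Q)$ for a point set $S$. $\mathcal{K}$ is a $(t\bmod q)$-arc if $\mathcal{K}(L)\equiv t\pmod q$ for every line $L$. (The classes $\mathcal{P}_1,\mathcal{P}_2$ are well defined since rescaling coordinates by $\lambda$ multiplies $F$ by $\lambda^2$.) A $(t\bmod q)$-arc $\mathcal{K}$ in $\mathrm{PG}(r,q)$ is called lifted if there exist an integer $s$ with $1\le s<r$, a projective $s$-space $\Sigma$, a projective $(r-s-1)$-space $\Gamma$ disjoint from $\Sigma$, and a $(t\bmod q)$-arc $\mathcal{K}_0$ in $\Sigma$ such that $\mathcal{K}(P)=t$ for every point $P\in\Gamma$ and $\mathcal{K}(Q)=\mathcal{K}_0(\langle\Gamma,Q\rangle\cap\Sigma)$ for every point $Q\notin\Gamma$. *)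

theory Defs
  imports
    "HOL-Analysis.Cartesian_Space"
    "HOL-Computational_Algebra.Nth_Powers"
    "HOL-Number_Theory.Number_Theory"
begin

(* PG(r,q) is modelled on the vector space 'a ^ 'n with CARD('a) = q and CARD('n) = r + 1.
   A projective subspace is represented by its underlying linear subspace, so that incidence
   is inclusion and two projective subspaces are disjoint iff they meet in {0}. *)

definition proj_point :: "('a::field) ^ 'n \<Rightarrow> ('a ^ 'n) set" where
  "proj_point x = vec.span {x}"

definition points_of :: "(('a::field) ^ 'n) set \<Rightarrow> ('a ^ 'n) set set" where
  "points_of U = {proj_point x | x. x \<noteq> 0 \<and> proj_point x \<subseteq> U}"

definition proj_subspace :: "nat \<Rightarrow> (('a::field) ^ 'n) set \<Rightarrow> bool" where
  "proj_subspace k U \<longleftrightarrow> vec.subspace U \<and> vec.dim U = k + 1"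

(* An arc is a function on sets of vectors; only its values at points are ever used. *)
type_synonym ('a, 'n) arc = "('a ^ 'n) set \<Rightarrow> nat"

(* K is a (t mod q)-arc in the projective space U; U = UNIV is all of PG(r,q). *)
definition mod_arc :: "nat \<Rightarrow> (('a::{field,finite}) ^ 'n) set \<Rightarrow> ('a, 'n) arc \<Rightarrow> bool" where
  "mod_arc t U K \<longleftrightarrow>
     (\<forall>L. proj_subspace 1 L \<and> L \<subseteq> U \<longrightarrow> [(\<Sum>P\<in>points_of L. K P) = t] (mod CARD('a)))"

(* The point <Gamma,Q> \<inter> Sigma is the intersection of the linear span of Gamma and Q with Sigma. *)
definition lifted :: "nat \<Rightarrow> ('a::{field,finite}, 'n::finite) arc \<Rightarrow> bool" where
  "lifted t K \<longleftrightarrow>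
     (let r = CARD('n) - 1 in
      \<exists>s \<Sigma> \<Gamma> K0. 1 \<le> s \<and> s < r \<and>
        proj_subspace s \<Sigma> \<and> proj_subspace (r - s - 1) \<Gamma> \<and> \<Gamma> \<inter> \<Sigma> = {0} \<and>
        mod_arc t \<Sigma> K0 \<and>
        (\<forall>P\<in>points_of \<Gamma>. K P = t) \<and>
        (\<forall>Q\<in>points_of UNIV - points_of \<Gamma>. K Q = K0 (vec.span (\<Gamma> \<union> Q) \<inter> \<Sigma>)))"

definition quadratic_form :: "(('a::field) ^ 'n \<Rightarrow> 'a) \<Rightarrow> bool" where
  "quadratic_form F \<longleftrightarrow>
     (\<exists>A :: 'a ^ 'n ^ 'n. \<forall>x. F x = (\<Sum>i\<in>UNIV. \<Sum>j\<in>UNIV. A $ i $ j * x $ i * x $ j))"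

definition polar_form :: "(('a::field) ^ 'n \<Rightarrow> 'a) \<Rightarrow> 'a ^ 'n \<Rightarrow> 'a ^ 'n \<Rightarrow> 'a" where
  "polar_form F x y = F (x + y) - F x - F y"

(* No singular points. In odd characteristic F x = polar_form F x x / 2, so the condition F x = 0
   is then redundant and this says that the polar form has trivial radical. *)
definition nondegenerate :: "(('a::field) ^ 'n \<Rightarrow> 'a) \<Rightarrow> bool" where
  "nondegenerate F \<longleftrightarrow> (\<forall>x. F x = 0 \<and> (\<forall>y. polar_form F x y = 0) \<longrightarrow> x = 0)"

definition quadric :: "(('a::field) ^ 'n \<Rightarrow> 'a) \<Rightarrow> ('a ^ 'n) set set" where
  "quadric F = {proj_point x | x. x \<noteq> 0 \<and> F x = 0}"

definition nonsquare_points :: "(('a::field) ^ 'n \<Rightarrow> 'a) \<Rightarrow> ('a ^ 'n) set set" where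
  "nonsquare_points F = {proj_point x | x. x \<noteq> 0 \<and> F x \<noteq> 0 \<and> \<not> is_square (F x)}"

definition square_points :: "(('a::field) ^ 'n \<Rightarrow> 'a) \<Rightarrow> ('a ^ 'n) set set" where
  "square_points F = {proj_point x | x. x \<noteq> 0 \<and> F x \<noteq> 0 \<and> is_square (F x)}"

definition arc1 :: "(('a::{field,finite}) ^ 'n \<Rightarrow> 'a) \<Rightarrow> ('a, 'n) arc" where
  "arc1 F P = (if P \<in> quadric F then (CARD('a) + 1) div 2
               else if P \<in> nonsquare_points F then 1 else 0)"

definition arc2 :: "(('a::{field,finite}) ^ 'n \<Rightarrow> 'a) \<Rightarrow> ('a, 'n) arc" where
  "arc2 F P = (if P \<in> quadric F then (CARD('a) + 1) div 2
               else if P \<in> square_points F then 1 else 0)"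

(* The three classes partition the points, so the if-cascades above define
   the intended values on each class. *)

lemma quadratic_form_scale:
  assumes "quadratic_form F"
  shows "F (c *s x) = c ^ 2 * F x"
  using assms unfolding quadratic_form_def
  by (auto simp: sum_distrib_left power2_eq_square mult_ac intro!: sum.cong)

lemma proj_point_eqE:
  assumes "proj_point x = proj_point y" "x \<noteq> 0"
  obtains c where "c \<noteq> 0" "x = c *s y"
proof -
  have "x \<in> vec.span {y}"
    using assms(1) vec.span_base[of x "{x}"] by (simp add: proj_point_def)
  then obtain c where "x = c *s y"
    by (auto simp: vec.span_singleton)
  with \<open>x \<noteq> 0\<close> that show thesis
    by (metis vec.scale_zero_left)
qed

lemma is_square_scale_iff:
  fixes c a :: "'a::field"
  assumes "c \<noteq> 0"
  shows "is_square (c ^ 2 * a) \<longleftrightarrow> is_square a"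
proof
  assume "is_square (c ^ 2 * a)"
  then obtain y where "c ^ 2 * a = y ^ 2" by (auto simp: is_nth_power_def)
  then have "a = (y / c) ^ 2" using assms by (simp add: power_divide field_simps)
  then show "is_square a" by (auto simp: is_nth_power_def)
next
  assume "is_square a"
  then show "is_square (c ^ 2 * a)" by (auto simp: is_nth_power_def simp flip: power_mult_distrib)
qed

lemma proj_point_mem_iff:
  assumes "quadratic_form F" "x \<noteq> 0"
  shows "proj_point x \<in> quadric F \<longleftrightarrow> F x = 0"
    and "proj_point x \<in> nonsquare_points F \<longleftrightarrow> F x \<noteq> 0 \<and> \<not> is_square (F x)"
    and "proj_point x \<in> square_points F \<longleftrightarrow> F x \<noteq> 0 \<and> is_square (F x)"
  using assms
  by (auto simp: quadric_def nonsquare_points_def square_points_def quadratic_form_scale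
      is_square_scale_iff elim!: proj_point_eqE)

lemma arc1_proj_point:
  fixes F :: "('a::{field,finite}) ^ 'n \<Rightarrow> 'a"
  assumes "quadratic_form F" "x \<noteq> 0"
  shows "arc1 F (proj_point x) =
    (if F x = 0 then (CARD('a) + 1) div 2 else if is_square (F x) then 0 else 1)"
  using proj_point_mem_iff[OF assms] by (simp add: arc1_def)

lemma arc2_proj_point:
  fixes F :: "('a::{field,finite}) ^ 'n \<Rightarrow> 'a"
  assumes "quadratic_form F" "x \<noteq> 0"
  shows "arc2 F (proj_point x) =
    (if F x = 0 then (CARD('a) + 1) div 2 else if is_square (F x) then 1 else 0)"
  using proj_point_mem_iff[OF assms] by (simp add: arc2_def)

end

theory Submission
  imports Defs
begin

text \<open>Modulo \<open>q\<close>, twice the arc is \<open>1 \<mp> \<chi> \<circ> F\<close> with \<open>\<chi>\<close> the quadratic character, so the line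
  condition says that \<open>q\<close> divides the sum of \<open>\<chi> \<circ> F\<close> over the \<open>q + 1\<close> points of a line. This is
  the classical evaluation of \<open>\<Sum>\<^sub>c \<chi> (a c\<^sup>2 + b c + d)\<close> by completing the square and counting the points of
  a hyperbola. If the arc were lifted, every point of the vertex \<open>\<Gamma>\<close> would be a singular point of
  the quadric.\<close>

section \<open>The quadratic character and its sums over a finite field\<close>

definition quadratic_character :: "'a::field \<Rightarrow> int" where
  "quadratic_character x = (if x = 0 then 0 else if is_square x then 1 else - 1)"

text \<open>The characteristic divides the order of the field, and \<open>2 = 0\<close> would force
  it to be 2.\<close>

lemma two_neq_zero_of_odd_CARD:
  assumes "odd CARD('a::{field,finite})"
  shows "(2::'a) \<noteq> 0"
proof
  assume "(2::'a) = 0"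
  then have "CHAR('a) dvd 2" using of_nat_eq_0_iff_char_dvd[where ?'a = 'a, of 2] by simp
  then have "CHAR('a) = 1 \<or> CHAR('a) = 2" using prime_nat_iff two_is_prime_nat by blast
  moreover have "CHAR('a) \<noteq> 1" using of_nat_CHAR[where ?'a = 'a] by (metis of_nat_1 zero_neq_one)
  ultimately show False using CHAR_dvd_CARD[where ?'a = 'a] assms by auto
qed

text \<open>The roots of \<open>y ^ 2\<close> are \<open>y\<close> and \<open>- y\<close>, which
  coincide only for \<open>y = 0\<close>. This turns character sums into point counts.\<close>

lemma card_square_roots:
  fixes x :: "'a::{field,finite}"
  assumes "(2::'a) \<noteq> 0"
  shows "int (card {z. z ^ 2 = x}) = 1 + quadratic_character x"
proof (cases "is_square x")
  case False
  then have "{z. z ^ 2 = x} = {}" "x \<noteq> 0"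
    by (auto simp: is_nth_power_def)
  then show ?thesis using False by (simp add: quadratic_character_def)
next
  case True
  then obtain y where y: "x = y ^ 2" by (auto simp: is_nth_power_def)
  then have set: "{z. z ^ 2 = x} = {y, - y}" by (auto simp: power2_eq_iff)
  have "y = - y \<longleftrightarrow> 2 * y = 0" by (metis add_eq_0_iff mult_2)
  then have "y = - y \<longleftrightarrow> y = 0" using assms by simp
  then show ?thesis using True y unfolding set
    by (cases "y = 0") (auto simp: quadratic_character_def)
qed

text \<open>Every \<open>z\<close> is a square root of exactly one \<open>x\<close>, so the root
  counts \<open>1 + quadratic_character x\<close> add up to the order of the field.\<close>

lemma sum_quadratic_character:
  assumes "(2::'a::{field,finite}) \<noteq> 0"
  shows "(\<Sum>x\<in>UNIV. quadratic_character (x::'a)) = 0"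
proof -
  have "(\<Sum>x\<in>UNIV. 1 + quadratic_character (x::'a)) = (\<Sum>x\<in>UNIV. int (card {z. z ^ 2 = (x::'a)}))"
    by (simp add: card_square_roots[OF assms])
  also have "\<dots> = (\<Sum>x\<in>UNIV. \<Sum>z | z \<in> UNIV \<and> z ^ 2 = (x::'a). 1)"
    by simp
  also have "\<dots> = (\<Sum>z\<in>(UNIV::'a set). 1)"
    by (rule sum.group) auto
  finally show ?thesis by (simp add: sum.distrib)
qed

lemma card_squares_eq_card_nonsquares:
  assumes "(2::'a::{field,finite}) \<noteq> 0"
  shows "card {x::'a. x \<noteq> 0 \<and> is_square x} = card {x::'a. \<not> is_square x}"
proof -
  have "quadratic_character x = of_bool (x \<noteq> 0 \<and> is_square x) - of_bool (\<not> is_square x)" for x :: 'a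
    by (auto simp: quadratic_character_def)
  then show ?thesis
    using sum_quadratic_character[OF assms]
    by (simp add: sum_subtractf sum_of_bool_eq)
qed

text \<open>Multiplication by \<open>a\<close> maps the nonzero squares injectively into the
  nonsquares, hence onto them, as both classes have the same size. So if \<open>a * b\<close> were a
  nonsquare, \<open>b\<close> would be a square.\<close>

lemma is_square_mult_nonsquares:
  fixes a b :: "'a::{field,finite}"
  assumes "(2::'a) \<noteq> 0" "\<not> is_square a" "\<not> is_square b"
  shows "is_square (a * b)"
proof (rule ccontr)
  assume ab: "\<not> is_square (a * b)"
  let ?S = "{x::'a. x \<noteq> 0 \<and> is_square x}" and ?N = "{x::'a. \<not> is_square x}"
  have a0: "a \<noteq> 0" using assms(2) by (auto simp: is_nth_power_def)
  have "(*) a ` ?S \<subseteq> ?N"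
  proof clarify
    fix x assume "x \<noteq> 0" "is_square x" "is_square (a * x)"
    then obtain y where "x = y ^ 2" "y \<noteq> 0" by (auto simp: is_nth_power_def)
    then show False
      using \<open>is_square (a * x)\<close> is_square_scale_iff[of y a] assms(2) by (simp add: mult.commute)
  qed
  moreover have "card ((*) a ` ?S) = card ?N"
    using a0 card_squares_eq_card_nonsquares[OF assms(1)] by (subst card_image) (auto simp: inj_on_def)
  ultimately have "(*) a ` ?S = ?N" by (intro card_subset_eq) auto
  then have "a * b \<in> (*) a ` ?S" using ab by simp
  then show False using a0 assms(3) by auto
qed

lemma quadratic_character_mult:
  fixes a b :: "'a::{field,finite}"
  assumes "(2::'a) \<noteq> 0"
  shows "quadratic_character (a * b) = quadratic_character a * quadratic_character b"
proof -
  have *: "is_square (x * y) \<longleftrightarrow> is_square y" if "x \<noteq> 0" "is_square x" for x y :: 'a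
    using that by (auto simp: is_nth_power_def[of 2 x] is_square_scale_iff)
  show ?thesis
    using is_square_mult_nonsquares[OF assms, of a b] *[of a b] *[of b a]
    by (auto simp: quadratic_character_def mult.commute)
qed

text \<open>For nonzero \<open>D\<close>, adding 1 to each term counts the points of the hyperbola
  \<open>z ^ 2 = y ^ 2 - D\<close>, of which there are \<open>CARD('a) - 1\<close>. For
  \<open>D = 0\<close> every term is 1 except the one at \<open>y = 0\<close>.\<close>

lemma sum_quadratic_character_square_minus:
  fixes D :: "'a::{field,finite}"
  assumes two: "(2::'a) \<noteq> 0"
  shows "(\<Sum>y\<in>UNIV. quadratic_character (y ^ 2 - D)) = (if D = 0 then int CARD('a) else 0) - 1"
proof (cases "D = 0")
  case True
  have "quadratic_character (y ^ 2) = 1 - of_bool (y = 0)" for y :: 'a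
    by (auto simp: quadratic_character_def)
  then show ?thesis using True by (simp add: sum_subtractf sum_of_bool_eq)
next
  case False
  let ?H = "SIGMA y:(UNIV::'a set). {z. z ^ 2 = y ^ 2 - D}"
  \<comment> \<open>The conic \<open>(y + z) (y - z) = D\<close> is parametrised by \<open>s = y + z\<close>.\<close>
  have four: "(4::'a) \<noteq> 0" using two by (metis mult_2 no_zero_divisors numeral_Bit0)
  have "bij_betw (\<lambda>(y, z). y + z) ?H (- {0})"
  proof (rule bij_betw_byWitness[where f' = "\<lambda>s. ((s + D / s) / 2, (s - D / s) / 2)"])
    show "\<forall>p\<in>?H. (\<lambda>s. ((s + D / s) / 2, (s - D / s) / 2)) ((\<lambda>(y, z). y + z) p) = p"
    proof
      fix p assume "p \<in> ?H"
      then obtain y z where p: "p = (y, z)" and "z ^ 2 = y ^ 2 - D" by blast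
      then have D: "D = (y + z) * (y - z)" by (simp add: algebra_simps power2_eq_square)
      \<comment> \<open>With \<open>s = y + z\<close>, the quotient \<open>D / s\<close> recovers
        \<open>y - z\<close>, so \<open>y\<close> and \<open>z\<close> are half the sum and half the
        difference of \<open>s\<close> and \<open>D / s\<close>.\<close>
      then have "D / (y + z) = y - z" using False by auto
      then show "(\<lambda>s. ((s + D / s) / 2, (s - D / s) / 2)) ((\<lambda>(y, z). y + z) p) = p"
        using two by (simp add: p field_simps)
    qed
    show "\<forall>s\<in>- {0}. (\<lambda>(y, z). y + z) ((s + D / s) / 2, (s - D / s) / 2) = s"
      using two four by (auto simp: field_simps)
    show "(\<lambda>(y, z). y + z) ` ?H \<subseteq> - {0}"
    proof clarify
      fix y z :: 'a assume "z ^ 2 = y ^ 2 - D" "y + z = 0"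
      then have "z = - y" by (simp add: add_eq_0_iff)
      then show False using False \<open>z ^ 2 = y ^ 2 - D\<close> by simp
    qed
    show "(\<lambda>s. ((s + D / s) / 2, (s - D / s) / 2)) ` (- {0}) \<subseteq> ?H"
    proof (rule image_subsetI)
      fix s :: 'a assume "s \<in> - {0}"
      then have "((s - D / s) / 2) ^ 2 = ((s + D / s) / 2) ^ 2 - D"
        using two four by (simp add: field_simps power2_eq_square)
      then show "((s + D / s) / 2, (s - D / s) / 2) \<in> ?H" by simp
    qed
  qed
  then have "card ?H = CARD('a) - 1"
    by (simp only: bij_betw_same_card Compl_eq_Diff_UNIV) simp
  moreover have "card ?H = (\<Sum>y\<in>UNIV. card {z. z ^ 2 = y ^ 2 - D})" by simp
  ultimately have "(\<Sum>y\<in>UNIV. int (card {z. z ^ 2 = y ^ 2 - D})) = int CARD('a) - 1"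
    by (metis One_nat_def Suc_leI int_ops(2) of_nat_diff of_nat_sum zero_less_card_finite)
  then show ?thesis using False by (simp add: card_square_roots[OF two] sum.distrib)
qed

text \<open>The value of the quadratic polynomial at infinity is its leading coefficient, so this is a
  character sum over a projective line.\<close>

lemma CARD_dvd_sum_quadratic_character:
  fixes a b d :: "'a::{field,finite}"
  assumes two: "(2::'a) \<noteq> 0"
  shows "int CARD('a) dvd
    quadratic_character a + (\<Sum>c\<in>UNIV. quadratic_character (d + c * b + c ^ 2 * a))"
proof (cases "a = 0")
  case a: True
  show ?thesis
  proof (cases "b = 0")
    case False
    \<comment> \<open>A nonconstant affine polynomial runs once through the field, so its character
      sum is the full one, which vanishes.\<close>
    have "bij (\<lambda>c. d + c * b)"
      by (rule bij_betw_byWitness[where f' = "\<lambda>x. (x - d) / b"]) (use False in auto)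
    then have "(\<Sum>c\<in>UNIV. quadratic_character (d + c * b)) = 0"
      using sum.reindex_bij_betw[of "\<lambda>c. d + c * b" UNIV UNIV quadratic_character]
        sum_quadratic_character[OF two] by simp
    then show ?thesis using a by (simp add: quadratic_character_def)
  qed (use a in \<open>simp add: quadratic_character_def\<close>)
next
  case False
  \<comment> \<open>Completing the square: \<open>D\<close> is the discriminant
    \<open>b ^ 2 - 4 * a * d\<close> divided by \<open>4 * a ^ 2\<close>.\<close>
  define D where "D = (b / (2 * a)) ^ 2 - d / a"
  have "d + c * b + c ^ 2 * a = a * ((c + b / (2 * a)) ^ 2 - D)" for c
  proof -
    \<comment> \<open>Free \<open>h\<close> and \<open>k\<close> keep the identity free of division,
      so that ring arithmetic settles it.\<close>
    have "a * ((c + h) ^ 2 - (h ^ 2 - k)) = a * k + c * (2 * a * h) + c ^ 2 * a" for h k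
      by (simp add: algebra_simps power2_eq_square)
    from this[of "b / (2 * a)" "d / a"] show ?thesis
      using False two by (simp add: D_def)
  qed
  then have "(\<Sum>c\<in>UNIV. quadratic_character (d + c * b + c ^ 2 * a)) =
      quadratic_character a * (\<Sum>c\<in>UNIV. quadratic_character ((c + b / (2 * a)) ^ 2 - D))"
    by (simp add: quadratic_character_mult[OF two] sum_distrib_left)
  also have "(\<Sum>c\<in>UNIV. quadratic_character ((c + b / (2 * a)) ^ 2 - D)) =
      (\<Sum>y\<in>UNIV. quadratic_character (y ^ 2 - D))"
    by (rule sum.reindex_bij_betw[of "\<lambda>c. c + b / (2 * a)" UNIV UNIV])
      (rule bij_betw_byWitness[where f' = "\<lambda>x. x - b / (2 * a)"], auto)
  \<comment> \<open>The \<open>- 1\<close> in the sum cancels the value at infinity, leaving 0 or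
    \<open>CARD('a)\<close> times \<open>quadratic_character a\<close>.\<close>
  finally show ?thesis
    by (simp add: sum_quadratic_character_square_minus[OF two] algebra_simps)
qed

section \<open>Quadratic forms along lines\<close>

lemma quadratic_form_add_scale:
  assumes "quadratic_form F"
  shows "F (x + c *s y) = F x + c * polar_form F x y + c ^ 2 * F y"
  using assms unfolding quadratic_form_def polar_form_def
  by (auto simp: algebra_simps sum.distrib sum_distrib_left power2_eq_square)

lemma polar_form_add_left:
  assumes "quadratic_form F"
  shows "polar_form F (x + y) z = polar_form F x z + polar_form F y z"
  using assms unfolding quadratic_form_def polar_form_def
  by (auto simp: algebra_simps sum.distrib sum_distrib_left)

lemma polar_form_commute: "polar_form F x y = polar_form F y x"
  by (simp add: polar_form_def add.commute)

section \<open>Points of a projective line\<close>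

lemma proj_line_basis:
  fixes L :: "('a::field ^ 'n::finite) set"
  assumes "proj_subspace 1 L"
  obtains u v where "u \<noteq> 0" "v \<notin> vec.span {u}" "L = vec.span {u, v}"
proof -
  have L: "vec.subspace L" "vec.dim L = 2" using assms by (auto simp: proj_subspace_def)
  obtain B where B: "B \<subseteq> L" "vec.independent B" "L \<subseteq> vec.span B" "card B = 2"
    using vec.basis_exists[of L] L by metis
  then obtain u v where uv: "B = {u, v}" "u \<noteq> v" by (meson card_2_iff)
  have "L = vec.span B" using B L by (metis vec.span_subspace)
  moreover have "u \<noteq> 0" using B uv vec.dependent_zero by blast
  moreover have "v \<notin> vec.span {u}"
    using B(2) uv vec.independent_insert[of v "{u}"] by (simp add: insert_commute)
  ultimately show thesis using that uv by blast
qed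

lemma proj_point_subset_iff:
  "vec.subspace U \<Longrightarrow> proj_point x \<subseteq> U \<longleftrightarrow> x \<in> U"
  unfolding proj_point_def by (meson insert_subset empty_subsetI subsetD vec.span_base vec.span_minimal insertI1)

lemma proj_point_scale: "c \<noteq> 0 \<Longrightarrow> proj_point (c *s x) = proj_point x"
  unfolding proj_point_def using vec.span_image_scale[of "{x}" "\<lambda>_. c"] by simp

lemma add_scale_notin_span_singleton:
  fixes u v :: "'a::field ^ 'n::finite"
  assumes "v \<notin> vec.span {u}"
  shows "v + c *s u \<notin> vec.span {u}" and "v + c *s u \<noteq> 0"
proof -
  show "v + c *s u \<notin> vec.span {u}"
    using assms by (simp add: vec.span_add_eq2 vec.span_base vec.span_scale)
  then show "v + c *s u \<noteq> 0" by (metis vec.span_zero)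
qed

text \<open>In a vector of the line, the coefficient of \<open>v\<close> is either 0, which gives
  the point of \<open>u\<close>, or can be scaled to 1.\<close>

lemma points_of_line:
  fixes u v :: "'a::{field,finite} ^ 'n::finite"
  assumes u: "u \<noteq> 0" and v: "v \<notin> vec.span {u}"
  shows "points_of (vec.span {u, v}) = insert (proj_point u) (range (\<lambda>c. proj_point (v + c *s u)))"
    (is "?L = ?R")
proof
  note nz = add_scale_notin_span_singleton(2)[OF v]
  have sub: "vec.subspace (vec.span {u, v})" by simp
  show "?R \<subseteq> ?L"
    using u nz unfolding points_of_def
    by (auto simp: proj_point_subset_iff[OF sub] intro!: vec.span_add vec.span_scale intro: vec.span_base)
  show "?L \<subseteq> ?R"
  proof
    fix P assume "P \<in> ?L"
    then obtain x where x: "x \<noteq> 0" "x \<in> vec.span {u, v}" "P = proj_point x"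
      unfolding points_of_def by (auto simp: proj_point_subset_iff[OF sub])
    then obtain k where "x - k *s v \<in> vec.span {u}"
      by (metis insert_commute vec.span_breakdown_eq)
    then obtain m where "x - k *s v = m *s u" by (auto simp: vec.span_singleton)
    then have xe: "x = k *s v + m *s u" by (simp add: algebra_simps)
    show "P \<in> ?R"
    proof (cases "k = 0")
      case True
      then have "P = proj_point u" using x xe proj_point_scale[of m u] by auto
      then show ?thesis by simp
    next
      case False
      then have "x = k *s (v + (m / k) *s u)" using xe by (simp add: vec.scale_right_distrib)
      then have "P = proj_point (v + (m / k) *s u)" using x False proj_point_scale by metis
      then show ?thesis by blast
    qed
  qed
qed

text \<open>The parametrisation is injective with \<open>u\<close> as its point at infinity: a
  coincidence of two points would make \<open>v\<close> a multiple of \<open>u\<close>.\<close>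

lemma sum_points_of_line:
  fixes u v :: "'a::{field,finite} ^ 'n::finite"
  assumes u: "u \<noteq> 0" and v: "v \<notin> vec.span {u}"
  shows "(\<Sum>P\<in>points_of (vec.span {u, v}). K P) =
    K (proj_point u) + (\<Sum>c\<in>UNIV. K (proj_point (v + c *s u)))"
proof -
  note v' = add_scale_notin_span_singleton(1)[OF v]
  have mem: "x \<in> proj_point x" for x :: "'a ^ 'n" by (simp add: proj_point_def vec.span_base)
  have "proj_point u \<notin> range (\<lambda>c. proj_point (v + c *s u))"
    using v' mem by (metis (no_types, lifting) imageE proj_point_def)
  moreover have "inj (\<lambda>c. proj_point (v + c *s u))"
  proof (rule injI)
    fix c d assume "proj_point (v + c *s u) = proj_point (v + d *s u)"
    then obtain k where k: "v + c *s u = k *s (v + d *s u)"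
      using mem[of "v + c *s u"] by (auto simp: proj_point_def vec.span_singleton)
    then have e: "(1 - k) *s v = (k * d - c) *s u" by (simp add: algebra_simps)
    have "k = 1"
    proof (rule ccontr)
      assume "k \<noteq> 1"
      then have "v = ((k * d - c) / (1 - k)) *s u"
        using e by (metis (no_types, lifting) divide_inverse mult.commute right_inverse
            right_minus_eq vec.scale_one vec.scale_scale)
      then show False using v by (metis insertI1 vec.span_base vec.span_scale)
    qed
    then show "c = d" using e u by simp
  qed
  ultimately show ?thesis
    unfolding points_of_line[OF assms] by (simp add: sum.reindex)
qed

section \<open>The arc condition and liftedness\<close>

text \<open>The sign \<open>e\<close> covers both arcs at once. Doubling the values avoids halves
  modulo the order of the field, which is odd, so the factor 2 can be cancelled at the end.\<close>

lemma mod_arc_of_quadratic_character: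
  fixes F :: "('a::{field,finite}) ^ 'n::finite \<Rightarrow> 'a" and e :: int
  assumes "odd CARD('a)" and F: "quadratic_form F"
    and K: "\<And>x. x \<noteq> 0 \<Longrightarrow>
      [2 * int (K (proj_point x)) = 1 + e * quadratic_character (F x)] (mod int CARD('a))"
  shows "mod_arc ((CARD('a) + 1) div 2) UNIV K"
  unfolding mod_arc_def
proof clarify
  fix L :: "('a ^ 'n) set" assume "proj_subspace 1 L"
  then obtain u v where u: "u \<noteq> 0" and v: "v \<notin> vec.span {u}" and L: "L = vec.span {u, v}"
    by (rule proj_line_basis)
  let ?q = "int CARD('a)" and ?t = "(CARD('a) + 1) div 2"
  let ?S = "quadratic_character (F u) + (\<Sum>c\<in>UNIV. quadratic_character (F (v + c *s u)))"
  have two: "(2::'a) \<noteq> 0" using assms(1) by (rule two_neq_zero_of_odd_CARD)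
  note nz = add_scale_notin_span_singleton(2)[OF v]
  have "?q dvd ?S"
    using CARD_dvd_sum_quadratic_character[OF two] by (simp add: quadratic_form_add_scale[OF F])
  then have S: "[?q + 1 + e * ?S = 2 * int ?t] (mod ?q)"
    using assms(1) by (auto simp: cong_iff_dvd_diff elim!: oddE)
  have "2 * int (\<Sum>P\<in>points_of L. K P) =
      2 * int (K (proj_point u)) + (\<Sum>c\<in>UNIV. 2 * int (K (proj_point (v + c *s u))))"
    unfolding L sum_points_of_line[OF u v] by (simp add: sum_distrib_left algebra_simps)
  also have "[\<dots> = (1 + e * quadratic_character (F u)) +
      (\<Sum>c\<in>UNIV. 1 + e * quadratic_character (F (v + c *s u)))] (mod ?q)"
    by (intro cong_add cong_sum K u nz)
  also have "(1 + e * quadratic_character (F u)) +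
      (\<Sum>c\<in>UNIV. 1 + e * quadratic_character (F (v + c *s u))) = ?q + 1 + e * ?S"
    by (simp add: sum.distrib sum_distrib_left algebra_simps)
  also note S
  finally have "[int (\<Sum>P\<in>points_of L. K P) = int ?t] (mod ?q)"
    using assms(1) by (subst (asm) cong_mult_lcancel) (auto simp: coprime_left_2_iff_odd)
  then show "[(\<Sum>P\<in>points_of L. K P) = ?t] (mod CARD('a))"
    using cong_int_iff by blast
qed

text \<open>Through a point \<open>u\<close> of \<open>\<Gamma>\<close>, liftedness forces \<open>K\<close> to be constant on every punctured line
  through \<open>u\<close> that is not contained in \<open>\<Gamma>\<close>, while \<open>F\<close> restricts there to an affine function.\<close>

lemma not_lifted_of_quadratic_form:
  fixes F :: "('a::{field,finite}) ^ 'n::finite \<Rightarrow> 'a"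
  assumes F: "quadratic_form F" and nd: "nondegenerate F"
    and K: "\<And>x. x \<noteq> 0 \<Longrightarrow> K (proj_point x) = t \<longleftrightarrow> F x = 0"
  shows "\<not> lifted t K"
proof
  assume "lifted t K"
  then obtain s \<Sigma> \<Gamma> K0 where \<Sigma>: "proj_subspace s \<Sigma>" and \<Gamma>: "proj_subspace (CARD('n) - 1 - s - 1) \<Gamma>"
    and disj: "\<Gamma> \<inter> \<Sigma> = {0}"
    and K\<Gamma>: "\<forall>P\<in>points_of \<Gamma>. K P = t"
    and K0: "\<forall>Q\<in>points_of UNIV - points_of \<Gamma>. K Q = K0 (vec.span (\<Gamma> \<union> Q) \<inter> \<Sigma>)"
    unfolding lifted_def Let_def by blast
  have sub: "vec.subspace \<Gamma>" using \<Gamma> by (simp add: proj_subspace_def)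
  \<comment> \<open>Projective dimension \<open>k\<close> means linear dimension
    \<open>k + 1\<close>, so \<Gamma> and \<Sigma> both contain points.\<close>
  have nonzero: "\<exists>x\<in>U. x \<noteq> 0" if "proj_subspace k U" for k and U :: "('a ^ 'n) set"
    using that vec.dim_eq_0[of U] by (auto simp: proj_subspace_def)
  obtain u where u: "u \<in> \<Gamma>" "u \<noteq> 0" using nonzero[OF \<Gamma>] by blast
  obtain w where w: "w \<notin> \<Gamma>" using nonzero[OF \<Sigma>] disj by blast
  have "proj_point u \<in> points_of \<Gamma>"
    using u unfolding points_of_def by (auto simp: proj_point_subset_iff[OF sub])
  then have Fu: "F u = 0" using K\<Gamma> K u by blast
  have outside: "polar_form F x u = 0" if x: "x \<notin> \<Gamma>" for x
  proof (rule ccontr)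
    assume b: "polar_form F x u \<noteq> 0"
    have val: "K (proj_point (x + c *s u)) = K0 (vec.span (insert x \<Gamma>) \<inter> \<Sigma>)" and
      nz: "x + c *s u \<noteq> 0" for c
    proof -
      have cu: "c *s u \<in> \<Gamma>" using u sub by (simp add: vec.subspace_scale)
      have xc: "x + c *s u \<notin> \<Gamma>"
        using x cu vec.subspace_diff[OF sub, of "x + c *s u" "c *s u"] by auto
      then show nz: "x + c *s u \<noteq> 0" using vec.subspace_0[OF sub] by metis
      have "proj_point (x + c *s u) \<notin> points_of \<Gamma>"
        using xc proj_point_subset_iff[OF sub, of "x + c *s u"] by (auto simp: points_of_def)
      moreover have "proj_point (x + c *s u) \<in> points_of UNIV"
        using nz by (auto simp: points_of_def)
      ultimately have "K (proj_point (x + c *s u)) =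
          K0 (vec.span (\<Gamma> \<union> proj_point (x + c *s u)) \<inter> \<Sigma>)"
        using K0 by blast
      also have "vec.span (\<Gamma> \<union> proj_point (x + c *s u)) = vec.span (insert (x + c *s u) \<Gamma>)"
        using vec.span_Un[of \<Gamma> "{x + c *s u}"] vec.span_Un[of \<Gamma> "proj_point (x + c *s u)"]
        by (simp add: proj_point_def vec.span_span)
      \<comment> \<open>Shifting \<open>x\<close> by an element of \<Gamma> does not change the
        span, so the value of \<open>K\<close> is independent of \<open>c\<close>.\<close>
      also have "\<dots> = vec.span (insert x \<Gamma>)"
        using vec.eq_span_insert_eq[of "x + c *s u" x \<Gamma>] cu by (simp add: vec.span_base)
      finally show "K (proj_point (x + c *s u)) = K0 (vec.span (insert x \<Gamma>) \<inter> \<Sigma>)" .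
    qed
    have Fc: "F (x + c *s u) = F x + c * polar_form F x u" for c
      by (simp add: quadratic_form_add_scale[OF F] Fu)
    have "F (x + c *s u) = 0 \<longleftrightarrow> F (x + d *s u) = 0" for c d
      using K[OF nz] val by metis
    \<comment> \<open>Along the shifts, \<open>F\<close> must vanish always or never, but an affine
      function with nonzero slope takes both values 0 and 1.\<close>
    moreover have "F (x + (- F x / polar_form F x u) *s u) = 0"
      "F (x + ((1 - F x) / polar_form F x u) *s u) = 1"
      unfolding Fc using b by simp_all
    ultimately show False by (metis zero_neq_one)
  qed
  have "polar_form F u x = 0" for x
  proof (cases "x \<in> \<Gamma>")
    case True
    \<comment> \<open>Both \<open>w\<close> and \<open>x + w\<close> lie outside \<Gamma>, so
      additivity carries the vanishing over to \<open>x\<close>.\<close>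
    then have "x + w \<notin> \<Gamma>" using w vec.subspace_diff[OF sub, of "x + w" x] by auto
    then show ?thesis
      using outside[of "x + w"] outside[OF w] polar_form_add_left[OF F, of x w u]
      by (simp add: polar_form_commute)
  qed (simp add: outside polar_form_commute[of F u])
  then show False using nd Fu u unfolding nondegenerate_def by blast
qed

theorem theorem5:
  fixes F :: "('a::{field,finite}) ^ 'n::finite \<Rightarrow> 'a"
    and q r :: nat
  assumes "primepow q" and "odd q" and "r \<ge> 2"
    and "CARD('a) = q" and "CARD('n) = r + 1"
    and "quadratic_form F"
  shows "mod_arc ((q + 1) div 2) UNIV (arc1 F) \<and>
         mod_arc ((q + 1) div 2) UNIV (arc2 F) \<and>
         (nondegenerate F \<longrightarrow>
            \<not> lifted ((q + 1) div 2) (arc1 F) \<and> \<not> lifted ((q + 1) div 2) (arc2 F))"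
proof -
  have odd: "odd CARD('a)" and q: "q = CARD('a)" using assms by auto
  have "q > 1" using assms(1) using primepow_gt_Suc_0 by simp
  \<comment> \<open>The field order is at least 3, so the value on the quadric differs from the
    values 0 and 1 off it.\<close>
  then have t: "(CARD('a) + 1) div 2 \<ge> 2" using assms(2,4) by (auto elim!: oddE)
  \<comment> \<open>On the quadric the doubled value is \<open>CARD('a) + 1\<close>, congruent to 1;
    off it the congruences below are equalities.\<close>
  have t2: "2 * int ((CARD('a) + 1) div 2) = int CARD('a) + 1" using odd by (auto elim!: oddE)
  have "[2 * int (arc1 F (proj_point x)) = 1 + (- 1) * quadratic_character (F x)] (mod int CARD('a))"
    if "x \<noteq> 0" for x
    using t2 by (auto simp: arc1_proj_point[OF assms(6) that] quadratic_character_def cong_iff_dvd_diff)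
  note 1 = mod_arc_of_quadratic_character[OF odd assms(6) this]
  have "[2 * int (arc2 F (proj_point x)) = 1 + 1 * quadratic_character (F x)] (mod int CARD('a))"
    if "x \<noteq> 0" for x
    using t2 by (auto simp: arc2_proj_point[OF assms(6) that] quadratic_character_def cong_iff_dvd_diff)
  note 2 = mod_arc_of_quadratic_character[OF odd assms(6) this]
  have "arc1 F (proj_point x) = (CARD('a) + 1) div 2 \<longleftrightarrow> F x = 0"
    "arc2 F (proj_point x) = (CARD('a) + 1) div 2 \<longleftrightarrow> F x = 0" if "x \<noteq> 0" for x
    using t by (auto simp: arc1_proj_point[OF assms(6) that] arc2_proj_point[OF assms(6) that])
  then show ?thesis
    unfolding q using 1 2 not_lifted_of_quadratic_form[OF assms(6)] by blast
qed

end
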